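(* Let $A, B \subseteq \mathbb{R}^2$ be two (nonempty) closed convex cones, and let $T_{DR}\colon\mathbb{R}^2\to\mathbb{R}^2$ be the Douglas--Rachford operator of the ordered pair $(A,B)$. (i) If $\operatorname{Fix} T_{DR}\neq \{0\}$, then there exists an $n\in \mathbb{N}$ such that $T_{DR}^n(\mathbb{R}^2) \subseteq \operatorname{Fix} T_{DR}$. That is, for every starting point $x_0\in \mathbb{R}^2$, the Douglas--Rachford method applied to $(A, B)$ reaches $\operatorname{Fix} T_{DR}$ in at most $n$ iterations, with $n$ independent of $x_0$. (ii) If $\operatorname{Fix} T_{DR} = \{0\}$, then for any $n\in \mathbb{N}$, $T_{DR}^n(\mathbb{R}^2\setminus \operatorname{Ker} T_{DR})\cap \operatorname{Fix} T_{DR} = \varnothing$. That is, the Douglas--Rachford method applied to $(A, B)$ from the starting point $x_0$ converges finitely if and only if $x_0\in \operatorname{Ker} T_{DR}$.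
   Context: $\mathbb{R}^2$ carries the standard inner product and Euclidean norm. A set $S$ is a cone if $\lambda x\in S$ for all $x\in S$ and all $\lambda\in(0,+\infty)$. For a nonempty closed convex set $C$, $P_C(x)$ is the unique nearest point of $C$ to $x$, and $R_C = 2P_C-\mathrm{Id}$ is the reflection operator. The Douglas--Rachford operator of the ordered pair $(A,B)$ is $T_{DR} = \frac12(\mathrm{Id}+R_B\circ R_A)$. $\operatorname{Fix} T=\{x : T(x)=x\}$ and $\operatorname{Ker} T=\{x: T(x)=0\}$. $T^n$ is the $n$-fold composition; the method started at $x_0$ generates $x_n=T_{DR}^n(x_0)$, and the method converges finitely from $x_0$ if $T_{DR}^n(x_0)\in\operatorname{Fix} T_{DR}$ for some $n\in\mathbb{N}$. *)

theory Defs
  imports "HOL-Analysis.Analysis"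
begin

(* The library's cone also requires closure under scaling by 0; here the scalars are
   strictly positive. *)
definition pos_cone :: "'a::real_vector set \<Rightarrow> bool" where
  "pos_cone S \<longleftrightarrow> (\<forall>x\<in>S. \<forall>c::real. c > 0 \<longrightarrow> c *\<^sub>R x \<in> S)"

(* closest_point is a well-defined projection only for nonempty closed convex C. *)
definition reflection_op :: "'a::euclidean_space set \<Rightarrow> 'a \<Rightarrow> 'a" where
  "reflection_op C x = 2 *\<^sub>R closest_point C x - x"

(* For the ordered pair (A, B), the reflection in A is applied first. *)
definition dr_op :: "'a::euclidean_space set \<Rightarrow> 'a set \<Rightarrow> 'a \<Rightarrow> 'a" where
  "dr_op A B x = (1/2) *\<^sub>R (x + (reflection_op B \<circ> reflection_op A) x)"

definition Fix :: "('a \<Rightarrow> 'a) \<Rightarrow> 'a set" where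
  "Fix T = {x. T x = x}"

definition Ker :: "('a::zero \<Rightarrow> 'a) \<Rightarrow> 'a set" where
  "Ker T = {x. T x = 0}"

definition dr_converges_finitely ::
    "'a::euclidean_space set \<Rightarrow> 'a set \<Rightarrow> 'a \<Rightarrow> bool" where
  "dr_converges_finitely A B x0 \<longleftrightarrow> (\<exists>n. (dr_op A B ^^ n) x0 \<in> Fix (dr_op A B))"

end

theory Submission
  imports Defs
begin

text \<open>
  Every closed convex cone splits a vector into a tangential part in the cone and an orthogonal
  normal part in the polar cone (Moreau). If \<open>x = p + q\<close> with respect to \<open>A\<close>, and the reflected point \<open>p - q\<close> is \<open>p' + q'\<close>
  with respect to \<open>B\<close>, then \<open>T x = p' + q\<close>. In particular \<open>T x\<close> is the midpoint of \<open>x\<close> and a vector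
  of the same length.

  If 0 is the only fixed point, a separation argument shows that \<open>A\<close> and \<open>B\<close> are complementary linear
  subspaces (\<open>trivial_Fix_uminus_closed\<close>). Then \<open>T\<close> is the mean of the identity and an isometry, and
  for such a map \<open>T (T x) = 0\<close> implies \<open>T x = 0\<close> (\<open>trivial_Fix_Ker_invariant\<close>). So an orbit that
  reaches 0 does so in one step. This half is valid in every dimension.

  If there is a nonzero fixed point, then \<open>A\<close> and \<open>B\<close> have a common direction \<open>v\<close>, or \<open>polar A\<close> and
  \<open>- polar B\<close> have one. The operator of the latter pair is again \<open>T\<close> (\<open>dr_op_polar\<close>), so the first
  alternative may be assumed. Let \<open>w\<close> be orthogonal to \<open>v\<close>. By monotonicity of \<open>T\<close>, at
  least one of the half-planes bounded by the line through \<open>v\<close> is invariant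
  (\<open>half_plane_dichotomy\<close>), and an orbit that stays on one side of the line turns towards \<open>v\<close>
  (\<open>clockwise_step\<close>). If \<open>p\<close>, \<open>q\<close>, \<open>p'\<close> and \<open>q'\<close> are all nonzero, the step is a rotation by the
  angle between a boundary line of \<open>A\<close> and one of \<open>B\<close>, together with a contraction by the cosine of
  this angle (\<open>norm_dr_op_generic\<close>). There are finitely many boundary lines, so unless the step is
  trivial or leads to 0, the angle to \<open>v\<close> drops by at least a fixed amount; this can happen only a
  bounded number of times. The degenerate steps, where one of the four vectors vanishes, lead to a
  fixed point or to the quadrant next to \<open>v\<close> after a bounded number of iterations
  (\<open>step_from_A\<close>, \<open>opposite_ray_only_if_fixed\<close>, \<open>step_from_polar\<close>). An orbit on the other side either
  behaves in the same way or enters the invariant half-plane, which gives the uniform bound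
  (\<open>uniformly_finite_half_plane\<close>).
\<close>

section \<open>Closed convex cones and their polars\<close>

definition closed_convex_cone :: "'a::euclidean_space set \<Rightarrow> bool" where
  "closed_convex_cone C \<longleftrightarrow> C \<noteq> {} \<and> closed C \<and> convex C \<and> pos_cone C"

definition polar :: "'a::euclidean_space set \<Rightarrow> 'a set" where
  "polar C = {q. \<forall>c\<in>C. q \<bullet> c \<le> 0}"

lemma cone_scaleR: "closed_convex_cone C \<Longrightarrow> x \<in> C \<Longrightarrow> c > 0 \<Longrightarrow> c *\<^sub>R x \<in> C"
  unfolding closed_convex_cone_def pos_cone_def by blast

lemma cone_zero:
  assumes "closed_convex_cone C"
  shows "0 \<in> C"
proof -
  obtain x where x: "x \<in> C" using assms unfolding closed_convex_cone_def by blast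
  have "(\<lambda>n. inverse (real (Suc n)) *\<^sub>R x) \<longlonglongrightarrow> 0 *\<^sub>R x"
    by (intro tendsto_intros LIMSEQ_inverse_real_of_nat)
  moreover have "inverse (real (Suc n)) *\<^sub>R x \<in> C" for n
    using cone_scaleR[OF assms x] by simp
  moreover have "closed C" using assms unfolding closed_convex_cone_def by blast
  ultimately show ?thesis
    by (metis (no_types, lifting) closed_sequentially scaleR_zero_left)
qed

lemma cone_scaleR_nonneg: "closed_convex_cone C \<Longrightarrow> x \<in> C \<Longrightarrow> c \<ge> 0 \<Longrightarrow> c *\<^sub>R x \<in> C"
  using cone_scaleR[of C x c] cone_zero[of C] by (cases "c = 0") auto

lemma cone_add:
  assumes "closed_convex_cone C" "x \<in> C" "y \<in> C"
  shows "x + y \<in> C"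
proof -
  have "convex C" using assms(1) unfolding closed_convex_cone_def by blast
  then have "(1/2) *\<^sub>R x + (1/2) *\<^sub>R y \<in> C"
    using assms(2,3) by (rule convexD) auto
  from cone_scaleR[OF assms(1) this, of 2] show ?thesis
    by (simp add: scaleR_add_right)
qed

lemma cone_combination:
  assumes "closed_convex_cone C" "x \<in> C" "y \<in> C" "a \<ge> 0" "b \<ge> 0"
  shows "a *\<^sub>R x + b *\<^sub>R y \<in> C"
  using assms by (intro cone_add cone_scaleR_nonneg)

lemma closed_convex_cone_polar: "closed_convex_cone (polar C)"
proof -
  have eq: "polar C = (\<Inter>c\<in>C. {q. q \<bullet> c \<le> 0})" unfolding polar_def by auto
  have "closed {q. q \<bullet> c \<le> 0}" "convex {q. q \<bullet> c \<le> 0}" for c :: 'a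
    using closed_halfspace_le[of c 0] convex_halfspace_le[of c 0]
    by (simp_all add: inner_commute)
  then have "closed (polar C)" "convex (polar C)"
    unfolding eq by (blast intro: closed_INT, blast intro: convex_INT)
  moreover have "0 \<in> polar C" unfolding polar_def by simp
  moreover have "pos_cone (polar C)"
    unfolding pos_cone_def polar_def by (auto simp: mult_le_0_iff)
  ultimately show ?thesis unfolding closed_convex_cone_def by blast
qed

lemma closed_convex_cone_uminus:
  assumes "closed_convex_cone C"
  shows "closed_convex_cone (uminus ` C)"
  using assms unfolding closed_convex_cone_def pos_cone_def
  by (force intro: closed_negations convex_negations)

text \<open>Existence half of Moreau's theorem; \<open>closest_point_cone_eqI\<close> is the uniqueness half. Together they
replace projections by a purely algebraic description.\<close>

lemma moreau_decomposition:
  assumes "closed_convex_cone C"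
  shows "closest_point C x \<in> C"
    and "x - closest_point C x \<in> polar C"
    and "closest_point C x \<bullet> (x - closest_point C x) = 0"
proof -
  define p where "p = closest_point C x"
  have C: "closed C" "convex C" "C \<noteq> {}" using assms unfolding closed_convex_cone_def by auto
  show p: "closest_point C x \<in> C" using C by (simp add: closest_point_in_set)
  have dot: "(x - p) \<bullet> (c - p) \<le> 0" if "c \<in> C" for c
    using closest_point_dot[OF C(2,1) that] unfolding p_def .
  \<comment> \<open>Comparing with the points 0 and 2p of the cone makes the residual orthogonal to p.\<close>
  have "(x - p) \<bullet> p = 0"
    using dot[OF cone_zero[OF assms]] dot[OF cone_scaleR[OF assms p, of 2]]
    by (simp add: scaleR_2 p_def)
  then show "closest_point C x \<bullet> (x - closest_point C x) = 0"
    unfolding p_def by (simp add: inner_commute)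
  show "x - closest_point C x \<in> polar C"
    using dot \<open>(x - p) \<bullet> p = 0\<close> unfolding polar_def p_def by (auto simp: inner_diff_right)
qed

lemma closest_point_cone_eqI:
  assumes "closed_convex_cone C" "p \<in> C" "q \<in> polar C" "p \<bullet> q = 0"
  shows "closest_point C (p + q) = p"
proof -
  have "dist (p + q) p \<le> dist (p + q) z" if "z \<in> C" for z
  proof -
    define n where "n = (p - z) \<bullet> (p - z)"
    have "q \<bullet> z \<le> 0" using assms(3) that unfolding polar_def by blast
    moreover have "(p + q - z) \<bullet> (p + q - z) = n + 2 * (p \<bullet> q - q \<bullet> z) + q \<bullet> q"
      unfolding n_def
      by (simp add: inner_diff_left inner_diff_right inner_add_left inner_add_right inner_commute)
    moreover have "n \<ge> 0" unfolding n_def by simp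
    ultimately have "q \<bullet> q \<le> (p + q - z) \<bullet> (p + q - z)" using assms(4) by simp
    then show ?thesis by (simp add: dist_norm norm_le)
  qed
  then show ?thesis
    using assms closest_point_unique[of C p "p + q"] unfolding closed_convex_cone_def by auto
qed

text \<open>By Moreau's theorem the projections onto a cone and onto its polar add up to the identity; this
is what makes the operator self-dual below.\<close>

lemma closest_point_polar:
  assumes "closed_convex_cone C"
  shows "closest_point (polar C) x = x - closest_point C x"
proof -
  define p q where "p = closest_point C x" and "q = x - p"
  have pq: "p \<in> C" "q \<in> polar C" "p \<bullet> q = 0"
    using moreau_decomposition[OF assms, of x] unfolding p_def q_def by auto
  have "p \<in> polar (polar C)" using pq(1) unfolding polar_def by (auto simp: inner_commute)
  then have "closest_point (polar C) (q + p) = q"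
    using pq by (intro closest_point_cone_eqI closed_convex_cone_polar) (simp_all add: inner_commute)
  then show ?thesis unfolding q_def p_def by simp
qed

lemma closest_point_uminus_image:
  assumes "closed_convex_cone C"
  shows "closest_point (uminus ` C) x = - closest_point C (- x)"
proof -
  define p q where "p = closest_point C (- x)" and "q = - x - p"
  have pq: "p \<in> C" "q \<in> polar C" "p \<bullet> q = 0"
    using moreau_decomposition[OF assms, of "- x"] unfolding p_def q_def by auto
  then have "closest_point (uminus ` C) (- p + - q) = - p"
    by (intro closest_point_cone_eqI closed_convex_cone_uminus assms) (auto simp: polar_def)
  then show ?thesis unfolding q_def p_def by simp
qed

section \<open>Moreau form of the Douglas--Rachford operator\<close>

text \<open>The point is \<open>x = p + q\<close> and its reflection in \<open>A\<close> is \<open>p - q = p' + q'\<close>, both in their Moreau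
decompositions. All later arguments are about these four vectors; the operator itself is
\<open>p' + q\<close>.\<close>

definition dr_split :: "'a::euclidean_space set \<Rightarrow> 'a set \<Rightarrow> 'a \<Rightarrow> 'a \<Rightarrow> 'a \<Rightarrow> 'a \<Rightarrow> 'a \<Rightarrow> bool" where
  "dr_split A B x p q p' q' \<longleftrightarrow>
     p \<in> A \<and> q \<in> polar A \<and> p \<bullet> q = 0 \<and> x = p + q \<and>
     p' \<in> B \<and> q' \<in> polar B \<and> p' \<bullet> q' = 0 \<and> p - q = p' + q'"

locale cone_pair =
  fixes A B :: "'a::euclidean_space set"
  assumes cone_A: "closed_convex_cone A" and cone_B: "closed_convex_cone B"
begin

abbreviation T :: "'a \<Rightarrow> 'a" where "T \<equiv> dr_op A B"

lemma dr_split_exists: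
  obtains p q p' q' where "dr_split A B x p q p' q'"
proof -
  define p where "p = closest_point A x"
  define q where "q = x - p"
  define p' where "p' = closest_point B (p - q)"
  have "dr_split A B x p q p' (p - q - p')"
    using moreau_decomposition[OF cone_A, of x] moreau_decomposition[OF cone_B, of "p - q"]
    unfolding dr_split_def p_def[symmetric] p'_def[symmetric] q_def[symmetric]
    by (simp add: q_def)
  then show ?thesis by (rule that)
qed

lemma reflection_split:
  assumes "dr_split A B x p q p' q'"
  shows "reflection_op A x = p - q" and "reflection_op B (p - q) = p' - q'"
    and "closest_point A x = p" and "closest_point B (p - q) = p'"
proof -
  show p: "closest_point A x = p" and p': "closest_point B (p - q) = p'"
    using assms closest_point_cone_eqI[OF cone_A] closest_point_cone_eqI[OF cone_B]
    unfolding dr_split_def by auto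
  show "reflection_op A x = p - q"
    using assms p unfolding dr_split_def reflection_op_def by (simp add: scaleR_2)
  have "p - q = p' + q'" using assms unfolding dr_split_def by simp
  then show "reflection_op B (p - q) = p' - q'"
    using p' unfolding reflection_op_def by (simp add: scaleR_2)
qed

lemma dr_op_split:
  assumes "dr_split A B x p q p' q'"
  shows "T x = p' + q"
proof -
  have x: "x = p + q" and "p - q = p' + q'" using assms unfolding dr_split_def by auto
  then have "p = p' + q' + q" by (simp add: algebra_simps)
  then have "x + (p' - q') = 2 *\<^sub>R (p' + q)" by (simp add: x scaleR_2)
  then show ?thesis unfolding dr_op_def using reflection_split[OF assms] by simp
qed

text \<open>Everything about the position of the image follows from the two normal parts \<open>q\<close> and \<open>q'\<close>. The
last identity places the image on the sphere with diameter \<open>[0, x]\<close>: the operator is the midpoint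
of \<open>x\<close> and a vector of the same length.\<close>

lemma dr_split_identities:
  assumes "dr_split A B x p q p' q'"
  shows "x - T x = q + q'" and "T x \<bullet> q = - (q \<bullet> q')" and "T x \<bullet> q' = q \<bullet> q'"
    and "x \<bullet> q = q \<bullet> q" and "x \<bullet> q' = q' \<bullet> q' + 2 * (q \<bullet> q')"
    and "T x \<bullet> (x - T x) = 0"
proof -
  note Tx = dr_op_split[OF assms]
  have h: "p \<bullet> q = 0" "p' \<bullet> q' = 0" "x = p + q" and y: "p - q = p' + q'"
    using assms unfolding dr_split_def by auto
  from y have p: "p = p' + q' + q" by (simp add: algebra_simps)
  have "p \<bullet> q = p' \<bullet> q + q' \<bullet> q + q \<bullet> q" unfolding p by (simp add: inner_add_left)
  then have q0: "p' \<bullet> q + q \<bullet> q' + q \<bullet> q = 0"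
    using h(1) by (simp add: inner_commute[of q' q])
  show 1: "x - T x = q + q'" using h(3) y unfolding Tx by (simp add: algebra_simps)
  show 2: "T x \<bullet> q = - (q \<bullet> q')" using q0 unfolding Tx by (simp add: inner_add_left)
  show 3: "T x \<bullet> q' = q \<bullet> q'" using h(2) unfolding Tx by (simp add: inner_add_left)
  show "x \<bullet> q = q \<bullet> q" using h(1) unfolding h(3) by (simp add: inner_add_left)
  show "x \<bullet> q' = q' \<bullet> q' + 2 * (q \<bullet> q')"
    using h(2) unfolding h(3) p by (simp add: inner_add_left)
  show "T x \<bullet> (x - T x) = 0" unfolding 1 using 2 3 by (simp add: inner_add_right)
qed

lemma dr_split_scaleR:
  assumes "dr_split A B x p q p' q'" "c > 0"
  shows "dr_split A B (c *\<^sub>R x) (c *\<^sub>R p) (c *\<^sub>R q) (c *\<^sub>R p') (c *\<^sub>R q')"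
  using assms cone_scaleR[OF cone_A _ assms(2)] cone_scaleR[OF cone_B _ assms(2)]
    cone_scaleR[OF closed_convex_cone_polar[of A] _ assms(2)]
    cone_scaleR[OF closed_convex_cone_polar[of B] _ assms(2)] unfolding dr_split_def
  by (simp flip: scaleR_add_right scaleR_diff_right)

lemma dr_op_scaleR:
  assumes "c > 0"
  shows "T (c *\<^sub>R x) = c *\<^sub>R T x"
proof -
  obtain p q p' q' where s: "dr_split A B x p q p' q'" by (rule dr_split_exists)
  show ?thesis
    using dr_op_split[OF s] dr_op_split[OF dr_split_scaleR[OF s assms]]
    by (simp add: scaleR_add_right)
qed

text \<open>Monotonicity reduces to the two inequalities \<open>(p - u) \<bullet> (q - v) \<ge> 0\<close> for Moreau decompositions \<open>p + q\<close> and \<open>u + v\<close> with respect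
to the same cone.\<close>

lemma dr_op_monotone: "(T x - T y) \<bullet> (x - y) \<ge> 0"
proof -
  obtain p q p' q' where s: "dr_split A B x p q p' q'" by (rule dr_split_exists)
  obtain u v u' v' where r: "dr_split A B y u v u' v'" by (rule dr_split_exists)
  define dp dq dp' dq' where d: "dp = p - u" "dq = q - v" "dp' = p' - u'" "dq' = q' - v'"
  have le: "q \<bullet> u \<le> 0" "v \<bullet> p \<le> 0" "q' \<bullet> u' \<le> 0" "v' \<bullet> p' \<le> 0"
    and eq: "p \<bullet> q = 0" "p' \<bullet> q' = 0" "u \<bullet> v = 0" "u' \<bullet> v' = 0"
    using s r unfolding dr_split_def polar_def by auto
  have g: "dp \<bullet> dq \<ge> 0" "dp' \<bullet> dq' \<ge> 0"
    using le eq unfolding d by (simp_all add: inner_diff_left inner_diff_right inner_commute)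
  have "p - q = p' + q'" "u - v = u' + v'" using s r unfolding dr_split_def by auto
  then have dp: "dp = dp' + dq' + dq" unfolding d by (simp add: algebra_simps)
  have xy: "x - y = dp + dq" using s r unfolding dr_split_def d by simp
  have Txy: "T x - T y = dp' + dq"
    using dr_op_split[OF s] dr_op_split[OF r] unfolding d by simp
  have "(T x - T y) \<bullet> (x - y) = (dp' + dq) \<bullet> (dp' + dq) + dp' \<bullet> dq' + dp \<bullet> dq"
    unfolding xy Txy dp
    by (simp add: inner_add_left inner_add_right inner_commute)
  then show ?thesis using g by (metis add_nonneg_nonneg inner_ge_zero)
qed

lemma Fix_T_iff: "x \<in> Fix T \<longleftrightarrow> T x = x" unfolding Fix_def by simp

lemma Fix_if_common: "x \<in> A \<Longrightarrow> x \<in> B \<Longrightarrow> x \<in> Fix T"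
  using dr_op_split[of x x 0 x 0] unfolding Fix_T_iff dr_split_def polar_def by simp

lemma Fix_if_polar: "x \<in> polar A \<Longrightarrow> - x \<in> polar B \<Longrightarrow> x \<in> Fix T"
  using dr_op_split[of x 0 x 0 "- x"] cone_zero[OF cone_A] cone_zero[OF cone_B]
  unfolding Fix_T_iff dr_split_def by simp

lemma zero_in_Fix: "0 \<in> Fix T"
  using Fix_if_common cone_zero cone_A cone_B by blast

text \<open>A fixed point has \<open>p' = p\<close> and \<open>q' = - q\<close>, so its tangential part is common to \<open>A\<close> and \<open>B\<close> and its
normal part is common to \<open>polar A\<close> and \<open>- polar B\<close>; a nonzero fixed point has a nonzero part.\<close>

lemma nonzero_Fix_cases:
  assumes "x \<in> Fix T" "x \<noteq> 0"
  obtains (primal) v where "v \<noteq> 0" "v \<in> A" "v \<in> B"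
    | (dual) v where "v \<noteq> 0" "v \<in> polar A" "- v \<in> polar B"
proof -
  obtain p q p' q' where s: "dr_split A B x p q p' q'" by (rule dr_split_exists)
  have "p' = p" and "q' = - q"
    using dr_op_split[OF s] assms(1) s unfolding Fix_T_iff dr_split_def
    by (auto simp: algebra_simps eq_neg_iff_add_eq_0)
  then show ?thesis
    using that s assms(2) unfolding dr_split_def by (cases "p = 0") auto
qed

lemma Fix_funpow: "x \<in> Fix T \<Longrightarrow> (T ^^ n) x = x"
  by (induction n) (auto simp: Fix_T_iff)

lemma funpow_Fix_mono:
  assumes "(T ^^ m) x \<in> Fix T" "m \<le> n"
  shows "(T ^^ n) x \<in> Fix T"
proof -
  have "(T ^^ n) x = (T ^^ (n - m)) ((T ^^ m) x)"
    using assms(2) by (metis funpow_add le_add_diff_inverse2 o_apply)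
  then show ?thesis using assms(1) Fix_funpow by metis
qed

lemma funpow_Fix_Suc: "(T ^^ n) (T x) \<in> Fix T \<Longrightarrow> Suc n \<le> m \<Longrightarrow> (T ^^ m) x \<in> Fix T"
  using funpow_Fix_mono[of "Suc n" x m] by (simp add: funpow_swap1)

end

text \<open>Reflection in the polar cone is minus reflection in the cone, and conjugating a reflection by
minus the identity reflects in the opposite cone. The two sign changes cancel in the composition.
Under this duality the two cases of \<open>nonzero_Fix_cases\<close> are exchanged.\<close>

lemma dr_op_polar:
  assumes "closed_convex_cone A" "closed_convex_cone B"
  shows "dr_op (polar A) (uminus ` polar B) = dr_op A B"
proof
  fix x
  have "reflection_op (polar A) x = - reflection_op A x" for x
    using closest_point_polar[OF assms(1)] unfolding reflection_op_def by (simp add: algebra_simps scaleR_2)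
  moreover have "closest_point (uminus ` polar B) (- x) = closest_point B x - x" for x
    using closest_point_uminus_image[OF closed_convex_cone_polar[of B], of "- x"]
      closest_point_polar[OF assms(2), of x] by simp
  then have "reflection_op (uminus ` polar B) (- x) = reflection_op B x" for x
    unfolding reflection_op_def by (simp add: scaleR_2)
  ultimately show "dr_op (polar A) (uminus ` polar B) x = dr_op A B x"
    unfolding dr_op_def by simp
qed

section \<open>A trivial fixed point set\<close>

context cone_pair
begin

text \<open>If only 0 is fixed, then \<open>A\<close> and \<open>B\<close> meet in 0 and no hyperplane separates them, so \<open>A - B\<close> is the
whole space. Writing \<open>- a = a' - b\<close> puts \<open>b = a + a'\<close> into both cones; hence \<open>b = 0\<close> and
\<open>- a = a'\<close> lies in \<open>A\<close>. Both cones are therefore linear subspaces.\<close>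

lemma trivial_Fix_uminus_closed:
  assumes "Fix T = {0}"
  shows "a \<in> A \<Longrightarrow> - a \<in> A" and "b \<in> B \<Longrightarrow> - b \<in> B"
proof -
  have AB: "z = 0" if "z \<in> A" "z \<in> B" for z using Fix_if_common[OF that] assms by blast
  have polars: "z = 0" if "z \<in> polar A" "- z \<in> polar B" for z
    using Fix_if_polar[OF that] assms by blast
  have diff: "\<exists>a\<in>A. \<exists>b\<in>B. z = a - b" for z
  proof (rule ccontr)
    assume no: "\<not> ?thesis"
    define S where "S = (\<Union>a\<in>A. \<Union>b\<in>B. {a - b})"
    have "convex S" using cone_A cone_B convex_differences
      unfolding S_def closed_convex_cone_def by blast
    then have "convex ((\<lambda>u. - z + u) ` S)" by (rule convex_translation)
    moreover have "0 \<notin> (\<lambda>u. - z + u) ` S" using no unfolding S_def by (auto simp: algebra_simps)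
    ultimately obtain h where h: "h \<noteq> 0" "\<forall>x\<in>(\<lambda>u. - z + u) ` S. 0 \<le> h \<bullet> x"
      using separating_hyperplane_set_0 by blast
    have le: "h \<bullet> z \<le> h \<bullet> a - h \<bullet> b" if "a \<in> A" "b \<in> B" for a b
      using h(2) that unfolding S_def by (force simp: inner_add_right inner_diff_right)
    \<comment> \<open>A linear functional bounded below on a cone is nonnegative there.\<close>
    have scale: "k \<ge> 0" if "\<And>c. c > 0 \<Longrightarrow> l \<le> c * k" for k l :: real
    proof (rule ccontr)
      assume "\<not> k \<ge> 0"
      then have k: "k < 0" by simp
      then have "l \<le> ((\<bar>l\<bar> + 1) / - k) * k" by (intro that) (simp add: divide_neg_pos divide_pos_neg)
      also have "\<dots> = - (\<bar>l\<bar> + 1)" using k by simp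
      finally show False by simp
    qed
    have "h \<bullet> a \<ge> 0" if "a \<in> A" for a
    proof (rule scale[of "h \<bullet> z"])
      fix c :: real assume "c > 0"
      then show "h \<bullet> z \<le> c * (h \<bullet> a)"
        using le[OF cone_scaleR[OF cone_A that] cone_zero[OF cone_B]] by simp
    qed
    moreover have "- (h \<bullet> b) \<ge> 0" if "b \<in> B" for b
    proof (rule scale[of "h \<bullet> z"])
      fix c :: real assume "c > 0"
      then show "h \<bullet> z \<le> c * - (h \<bullet> b)"
        using le[OF cone_zero[OF cone_A] cone_scaleR[OF cone_B that]] by simp
    qed
    ultimately have "- h \<in> polar A" "- (- h) \<in> polar B" unfolding polar_def by auto
    then show False using polars h(1) by fastforce
  qed
  show "- a \<in> A" if a: "a \<in> A"
  proof -
    obtain a' b where ab: "a' \<in> A" "b \<in> B" "- a = a' - b" using diff by blast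
    then have "b = a + a'" by (simp add: algebra_simps)
    moreover have "b = 0" using AB[of b] cone_add[OF cone_A a ab(1)] ab(2) \<open>b = a + a'\<close> by simp
    ultimately show ?thesis using ab by simp
  qed
  show "- b \<in> B" if b: "b \<in> B"
  proof -
    obtain a b' where ab: "a \<in> A" "b' \<in> B" "b = a - b'" using diff by blast
    then have "a = b + b'" by (simp add: algebra_simps)
    moreover have "a = 0" using AB[of a] cone_add[OF cone_B b ab(2)] ab(1) \<open>a = b + b'\<close> by simp
    ultimately show ?thesis using ab by simp
  qed
qed

text \<open>For subspaces the composition \<open>U\<close> of the reflections preserves inner products. With \<open>y = T x\<close> and
\<open>T y = 0\<close> one has \<open>U y = - y\<close> and \<open>2 y = x + U x\<close>, so
\<open>2 (y \<bullet> y) = x \<bullet> y + U x \<bullet> y = x \<bullet> y - U x \<bullet> U y = 0\<close>.\<close>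

lemma trivial_Fix_Ker_invariant:
  assumes triv: "Fix T = {0}" and "T (T x) = 0"
  shows "T x = 0"
proof -
  define y where "y = T x"
  obtain p q p' q' where s: "dr_split A B x p q p' q'" by (rule dr_split_exists)
  obtain u v u' v' where r: "dr_split A B y u v u' v'" by (rule dr_split_exists)
  have orth: "q \<bullet> a = 0" if "q \<in> polar C" "a \<in> C" "- a \<in> C" for q a :: 'a and C
  proof -
    have "q \<bullet> a \<le> 0" "q \<bullet> (- a) \<le> 0" using that unfolding polar_def by blast+
    then show ?thesis by simp
  qed
  note neg = trivial_Fix_uminus_closed[OF triv]
  have z: "p \<bullet> v = 0" "u \<bullet> q = 0" "p' \<bullet> v' = 0" "u' \<bullet> q' = 0"
    using s r neg orth[of q A u] orth[of v A p] orth[of q' B u'] orth[of v' B p']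
    unfolding dr_split_def by (auto simp: inner_commute)
  have eqs: "x = p + q" "y = u + v" "p - q = p' + q'" "u - v = u' + v'"
    using s r unfolding dr_split_def by auto
  have "u' + v = 0" using dr_op_split[OF r] assms(2) unfolding y_def by simp
  then have u': "u' = - v" by (simp add: eq_neg_iff_add_eq_0)
  then have "v' = u" using eqs(4) by (simp add: algebra_simps)
  then have Uy: "u' - v' = - y" using eqs(2) u' by simp
  have "x \<bullet> y = (p - q) \<bullet> (u - v)" unfolding eqs(1,2) using z
    by (simp add: inner_add_left inner_add_right inner_diff_left inner_diff_right inner_commute)
  also have "\<dots> = (p' - q') \<bullet> (u' - v')" unfolding eqs(3,4) using z
    by (simp add: inner_add_left inner_add_right inner_diff_left inner_diff_right inner_commute)
  finally have "x \<bullet> y = - ((p' - q') \<bullet> y)" unfolding Uy by simp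
  then have "(x + (p' - q')) \<bullet> y = 0" unfolding inner_add_left by simp
  moreover have "x + (p' - q') = 2 *\<^sub>R y"
    using dr_split_identities(1)[OF s] dr_op_split[OF s] unfolding y_def
    by (simp add: scaleR_2 algebra_simps)
  ultimately have "y \<bullet> y = 0" by simp
  then show ?thesis unfolding y_def by simp
qed

lemma trivial_Fix_funpow_zero:
  assumes "Fix T = {0}" "(T ^^ n) x = 0"
  shows "T x = 0"
  using assms(2)
proof (induction n arbitrary: x)
  case 0
  then show ?case using zero_in_Fix by (simp add: Fix_T_iff)
next
  case (Suc n)
  then have "(T ^^ n) (T x) = 0" by (simp add: funpow_swap1)
  then show ?case using Suc.IH trivial_Fix_Ker_invariant[OF assms(1)] by blast
qed

end

section \<open>Two cones in the plane with a common direction\<close>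

text \<open>The vectors \<open>v\<close> and \<open>w\<close> form an orthonormal basis, so the space is a plane, and \<open>v\<close> spans a ray common
to both cones. The two choices of sign for \<open>w\<close> are interchangeable, which allows every statement
about the upper half-plane \<open>x \<bullet> w \<ge> 0\<close> to be used for the lower one.\<close>

locale planar_cone_pair = cone_pair A B for A B :: "'a::euclidean_space set" +
  fixes v w :: 'a
  assumes v_in: "v \<in> A" "v \<in> B"
    and orthonormal: "v \<bullet> v = 1" "w \<bullet> w = 1" "v \<bullet> w = 0"
    and expand: "x = (x \<bullet> v) *\<^sub>R v + (x \<bullet> w) *\<^sub>R w"
begin

lemma planar_cone_pair_uminus: "planar_cone_pair A B v (- w)"
  using v_in orthonormal by unfold_locales (simp_all add: expand[symmetric])

lemma coords_eqI:
  assumes "x \<bullet> v = y \<bullet> v" "x \<bullet> w = y \<bullet> w"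
  shows "x = y"
  using expand[of x] expand[of y] assms by simp

lemma inner_coords: "x \<bullet> y = (x \<bullet> v) * (y \<bullet> v) + (x \<bullet> w) * (y \<bullet> w)"
proof -
  have "x \<bullet> y = x \<bullet> ((y \<bullet> v) *\<^sub>R v + (y \<bullet> w) *\<^sub>R w)" using expand[of y] by simp
  then show ?thesis by (simp add: inner_add_right)
qed

lemma coords_v: "v \<bullet> w = 0" "w \<bullet> v = 0" "v \<bullet> v = 1" "w \<bullet> w = 1"
  using orthonormal by (auto simp: inner_commute)

text \<open>Parseval's identity for the orthogonal pair \<open>p, q\<close>, multiplied out so that it also holds when one
of the two vectors is 0. It is used to express that there is no third direction.\<close>

lemma parseval:
  fixes p q y :: 'a
  assumes "p \<bullet> q = 0"
  shows "(y \<bullet> y) * (p \<bullet> p) * (q \<bullet> q) = (y \<bullet> p)\<^sup>2 * (q \<bullet> q) + (y \<bullet> q)\<^sup>2 * (p \<bullet> p)"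
proof -
  have "(e*e + f*f) * (a*a + b*b) * (c*c + d*d)
      = (e*a + f*b)\<^sup>2 * (c*c + d*d) + (e*c + f*d)\<^sup>2 * (a*a + b*b)"
    if "a * c + b * d = 0" for a b c d e f :: real
    using that by algebra
  then show ?thesis
    using assms inner_coords[of p q] inner_coords[of y y] inner_coords[of p p]
      inner_coords[of q q] inner_coords[of y p] inner_coords[of y q] by presburger
qed

section \<open>Contraction factors\<close>

text \<open>The possible directions of \<open>p\<close> in a Moreau decomposition \<open>p + q\<close> with both parts nonzero.\<close>

definition boundary_directions :: "'a set \<Rightarrow> 'a set" where
  "boundary_directions C = {u \<in> C. u \<bullet> u = 1 \<and> (\<exists>q \<in> polar C. q \<noteq> 0 \<and> u \<bullet> q = 0)}"

text \<open>A planar cone has at most two boundary rays. A unit vector \<open>u\<close> with an outer normal has \<open>J u\<close> or \<open>- J u\<close> as a normal, \<open>J\<close> being the rotation by a right angle. Two such vectors with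
the same sign lie in each other's half-planes, and as \<open>J\<close> is skew they must be parallel.\<close>

lemma finite_boundary_directions:
  assumes "closed_convex_cone C"
  shows "finite (boundary_directions C)"
proof -
  define J where "J u = (u \<bullet> v) *\<^sub>R w - (u \<bullet> w) *\<^sub>R v" for u
  define S where "S \<sigma> = {u \<in> C. u \<bullet> u = 1 \<and> \<sigma> *\<^sub>R J u \<in> polar C}" for \<sigma> :: real
  have J_coords: "J u \<bullet> v = - (u \<bullet> w)" "J u \<bullet> w = u \<bullet> v" for u
    unfolding J_def by (simp_all add: inner_diff_left coords_v)
  have J_skew: "J u \<bullet> z = - (J z \<bullet> u)" for u z
    unfolding inner_coords[of "J u" z] inner_coords[of "J z" u] J_coords by simp
  have fin: "finite (S \<sigma>)" if "\<sigma> \<noteq> 0" for \<sigma>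
  proof (cases "S \<sigma> = {}")
    case False
    then obtain u0 where u0: "u0 \<in> S \<sigma>" by blast
    have "u = u0 \<or> u = - u0" if "u \<in> S \<sigma>" for u
    proof -
      have "(\<sigma> *\<^sub>R J u) \<bullet> u0 \<le> 0" "(\<sigma> *\<^sub>R J u0) \<bullet> u \<le> 0"
        using that u0 unfolding S_def polar_def by blast+
      then have "\<sigma> * (J u \<bullet> u0) = 0" using J_skew[of u u0] by simp
      then have J0: "J u0 \<bullet> u = 0" using \<open>\<sigma> \<noteq> 0\<close> J_skew[of u u0] by simp
      have "u \<bullet> u = 1" "u0 \<bullet> u0 = 1" using that u0 unfolding S_def by auto
      then have n: "(u \<bullet> v)\<^sup>2 + (u \<bullet> w)\<^sup>2 = 1" "(u0 \<bullet> v)\<^sup>2 + (u0 \<bullet> w)\<^sup>2 = 1"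
        using inner_coords[of u u] inner_coords[of u0 u0] by (simp_all add: power2_eq_square)
      have c: "(u0 \<bullet> v) * (u \<bullet> w) = (u0 \<bullet> w) * (u \<bullet> v)"
        using J0 inner_coords[of "J u0" u] J_coords[of u0] by simp
      \<comment> \<open>The vector \<open>u\<close> is parallel to the unit vector \<open>u0\<close>, so it is its projection onto it.\<close>
      define k where "k = (u \<bullet> v) * (u0 \<bullet> v) + (u \<bullet> w) * (u0 \<bullet> w)"
      have "u \<bullet> v = k * (u0 \<bullet> v)" "u \<bullet> w = k * (u0 \<bullet> w)"
        using n(2) c unfolding k_def by algebra+
      then have uk: "u = k *\<^sub>R u0" by (intro coords_eqI) simp_all
      then have "k * k = 1" using \<open>u \<bullet> u = 1\<close> \<open>u0 \<bullet> u0 = 1\<close> by simp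
      then have "k = 1 \<or> k = - 1" by (metis power2_eq_1_iff power2_eq_square)
      then show ?thesis using uk by auto
    qed
    then show ?thesis by (intro finite_subset[of "S \<sigma>" "{u0, - u0}"]) auto
  qed simp
  have "boundary_directions C \<subseteq> S 1 \<union> S (- 1)"
  proof
    fix u assume "u \<in> boundary_directions C"
    then obtain q where u: "u \<in> C" "u \<bullet> u = 1" and q: "q \<in> polar C" "q \<noteq> 0" "u \<bullet> q = 0"
      unfolding boundary_directions_def by blast
    define k where "k = J u \<bullet> q"
    have n: "(u \<bullet> v)\<^sup>2 + (u \<bullet> w)\<^sup>2 = 1"
      using u(2) inner_coords[of u u] by (simp add: power2_eq_square)
    have o: "(u \<bullet> v) * (q \<bullet> v) + (u \<bullet> w) * (q \<bullet> w) = 0" using q(3) inner_coords[of u q] by simp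
    have k: "k = (u \<bullet> v) * (q \<bullet> w) - (u \<bullet> w) * (q \<bullet> v)"
      unfolding k_def inner_coords[of "J u" q] J_coords by simp
    have "q \<bullet> v = - (k * (u \<bullet> w))" "q \<bullet> w = k * (u \<bullet> v)"
      using n o unfolding k by algebra+
    then have qk: "q = k *\<^sub>R J u" by (intro coords_eqI) (simp_all add: J_coords)
    then have "k \<noteq> 0" using q(2) by auto
    then have "J u = (1 / k) *\<^sub>R q" unfolding qk by simp
    then have "k > 0 \<Longrightarrow> J u \<in> polar C" "k < 0 \<Longrightarrow> - J u \<in> polar C"
      using cone_scaleR[OF closed_convex_cone_polar q(1), of "1 / \<bar>k\<bar>"] by auto
    then show "u \<in> S 1 \<union> S (- 1)" using u \<open>k \<noteq> 0\<close> unfolding S_def by fastforce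
  qed
  moreover have "finite (S 1 \<union> S (- 1))" using fin[of 1] fin[of "- 1"] by simp
  ultimately show ?thesis by (rule finite_subset)
qed

text \<open>The vector \<open>p - q\<close> is the mirror image of \<open>x\<close> in the line through \<open>p\<close>, and \<open>p' - q'\<close> is that of
\<open>p' + q'\<close> in the line through \<open>p'\<close>. Hence \<open>T x\<close> is the midpoint of \<open>x\<close> and of \<open>x\<close> rotated by twice
the angle of these lines: \<open>x\<close> is rotated by the angle and shrunk by its cosine.\<close>

lemma norm_dr_op_generic:
  assumes s: "dr_split A B x p q p' q'" and "p \<noteq> 0" "q \<noteq> 0" "p' \<noteq> 0"
  shows "norm (T x) = \<bar>(p /\<^sub>R norm p) \<bullet> (p' /\<^sub>R norm p')\<bar> * norm x"
proof -
  have h: "p \<bullet> q = 0" "p' \<bullet> q' = 0" "x = p + q" "p - q = p' + q'"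
    using s unfolding dr_split_def by auto
  define a b P Q P' where d: "a = p' \<bullet> p" "b = p' \<bullet> q" "P = p \<bullet> p" "Q = q \<bullet> q" "P' = p' \<bullet> p'"
  have par: "P' * P * Q = a\<^sup>2 * Q + b\<^sup>2 * P" using parseval[OF h(1)] unfolding d .
  have "p' \<bullet> (p - q) = p' \<bullet> p'" unfolding h(4) using h(2) by (simp add: inner_add_right)
  then have P': "P' = a - b" unfolding d by (simp add: inner_diff_right)
  have x: "x \<bullet> x = P + Q"
    using h(1) unfolding h(3) d by (simp add: inner_add_left inner_add_right inner_commute)
  have "T x \<bullet> T x = P' + 2 * b + Q"
    unfolding dr_op_split[OF s] d by (simp add: inner_add_left inner_add_right inner_commute)
  then have Tx: "T x \<bullet> T x = a + b + Q" using P' by simp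
  have pos: "P > 0" "P' > 0" unfolding d using assms by auto
  \<comment> \<open>This is the square of the claim, cleared of denominators.\<close>
  have "(a + b + Q) * P * P' = a\<^sup>2 * (P + Q)" using par unfolding P' by algebra
  then have "T x \<bullet> T x = a\<^sup>2 / (P * P') * (x \<bullet> x)"
    using pos unfolding Tx x by (simp add: field_simps)
  also have "a\<^sup>2 / (P * P') = (a / (norm p * norm p'))\<^sup>2"
    unfolding d by (simp add: power_divide power_mult_distrib power2_norm_eq_inner)
  also have "a / (norm p * norm p') = (p /\<^sub>R norm p) \<bullet> (p' /\<^sub>R norm p')"
    unfolding d by (simp add: divide_inverse inner_commute)
  finally have "(norm (T x))\<^sup>2 = (\<bar>(p /\<^sub>R norm p) \<bullet> (p' /\<^sub>R norm p')\<bar> * norm x)\<^sup>2"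
    by (simp add: power2_norm_eq_inner power_mult_distrib)
  then show ?thesis by (rule power2_eq_imp_eq) auto
qed

lemma norm_dr_op_eq_imp_fixed:
  assumes "norm (T x) = norm x"
  shows "T x = x"
proof -
  obtain p q p' q' where s: "dr_split A B x p q p' q'" by (rule dr_split_exists)
  have "T x \<bullet> (x - T x) = 0" by (rule dr_split_identities(6)[OF s])
  then have "T x \<bullet> x = T x \<bullet> T x" by (simp add: inner_diff_right)
  moreover have "T x \<bullet> T x = x \<bullet> x" using assms by (simp add: norm_eq)
  ultimately have "(x - T x) \<bullet> (x - T x) = 0"
    by (simp add: inner_diff_left inner_diff_right inner_commute)
  then show ?thesis by simp
qed

definition generic_contraction_factor :: "real \<Rightarrow> bool" where
  "generic_contraction_factor \<rho> \<longleftrightarrow> 0 \<le> \<rho> \<and> \<rho> < 1 \<and>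
     (\<forall>x p q p' q'. dr_split A B x p q p' q' \<longrightarrow> p \<noteq> 0 \<longrightarrow> q \<noteq> 0 \<longrightarrow> p' \<noteq> 0 \<longrightarrow> q' \<noteq> 0 \<longrightarrow>
        T x = x \<or> norm (T x) \<le> \<rho> * norm x)"

text \<open>Only finitely many pairs of boundary lines occur, so the contraction factors that differ from 1
are bounded away from 1. Together with \<open>ang_clockwise_step\<close> this gives a positive lower bound for
the angle of rotation.\<close>

lemma generic_contraction:
  obtains \<rho> where "generic_contraction_factor \<rho>"
proof -
  define R where "R = (\<lambda>(u, u'). \<bar>u \<bullet> u'\<bar>) ` (boundary_directions A \<times> boundary_directions B)"
  \<comment> \<open>The element 0 makes the maximum exist, even if every factor in \<open>R\<close> is 1.\<close>
  define R1 where "R1 = insert 0 {r \<in> R. r < 1}"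
  have "finite R" unfolding R_def
    by (intro finite_imageI finite_cartesian_product finite_boundary_directions cone_A cone_B)
  then have fin: "finite R1" unfolding R1_def by simp
  have "Max R1 \<in> R1" using fin R1_def by (intro Max_in) auto
  then have "Max R1 < 1" unfolding R1_def by auto
  moreover have "0 \<le> Max R1" using fin by (intro Max_ge) (auto simp: R1_def)
  moreover have "T x = x \<or> norm (T x) \<le> Max R1 * norm x"
    if s: "dr_split A B x p q p' q'" and nz: "p \<noteq> 0" "q \<noteq> 0" "p' \<noteq> 0" "q' \<noteq> 0" for x p q p' q'
  proof -
    define u u' where uu': "u = p /\<^sub>R norm p" "u' = p' /\<^sub>R norm p'"
    have unit: "u \<bullet> u = 1" "u' \<bullet> u' = 1"
      using nz unfolding uu' by (simp_all flip: power2_norm_eq_inner)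
    have "u \<in> A" "u' \<in> B"
      using s nz cone_scaleR[OF cone_A] cone_scaleR[OF cone_B] unfolding uu' dr_split_def by simp_all
    then have "u \<in> boundary_directions A" "u' \<in> boundary_directions B"
      using s nz unit unfolding boundary_directions_def dr_split_def uu' by auto
    then have R: "\<bar>u \<bullet> u'\<bar> \<in> R" unfolding R_def by force
    have "\<bar>u \<bullet> u'\<bar> \<le> 1" using Cauchy_Schwarz_ineq2[of u u'] unit by (simp add: norm_eq_sqrt_inner)
    have n: "norm (T x) = \<bar>u \<bullet> u'\<bar> * norm x" using norm_dr_op_generic[OF s nz(1-3)] unfolding uu' .
    show ?thesis
    proof (cases "\<bar>u \<bullet> u'\<bar> < 1")
      case True
      then have "\<bar>u \<bullet> u'\<bar> \<le> Max R1" using R fin by (intro Max_ge) (auto simp: R1_def)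
      then show ?thesis unfolding n by (simp add: mult_right_mono)
    next
      case False
      then have "norm (T x) = norm x" using n \<open>\<bar>u \<bullet> u'\<bar> \<le> 1\<close> by simp
      then show ?thesis using norm_dr_op_eq_imp_fixed by blast
    qed
  qed
  ultimately have "generic_contraction_factor (Max R1)"
    unfolding generic_contraction_factor_def by blast
  then show ?thesis by (rule that)
qed

section \<open>Position relative to the common direction\<close>

lemma inner_v_mono: "x \<bullet> v \<le> T x \<bullet> v"
proof -
  obtain p q p' q' where s: "dr_split A B x p q p' q'" by (rule dr_split_exists)
  have "q \<bullet> v \<le> 0" "q' \<bullet> v \<le> 0" using s v_in unfolding dr_split_def polar_def by auto
  then have "(x - T x) \<bullet> v \<le> 0"
    unfolding dr_split_identities(1)[OF s] by (simp add: inner_add_left)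
  then show ?thesis by (simp add: inner_diff_left)
qed

lemma orthogonal_step: "(T x \<bullet> v) * (x \<bullet> v - T x \<bullet> v) + (T x \<bullet> w) * (x \<bullet> w - T x \<bullet> w) = 0"
proof -
  obtain p q p' q' where s: "dr_split A B x p q p' q'" by (rule dr_split_exists)
  show ?thesis
    using dr_split_identities(6)[OF s] inner_coords[of "T x" "x - T x"]
    by (simp add: inner_diff_left)
qed

text \<open>A point of the circle with diameter \<open>[0, x]\<close> below the line through \<open>v\<close> would have a smaller component
along \<open>v\<close> than \<open>x\<close>, while \<open>T\<close> does not decrease that component.\<close>

lemma quadrant_invariant:
  assumes "x \<bullet> v \<ge> 0" "x \<bullet> w \<ge> 0"
  shows "T x \<bullet> w \<ge> 0"
proof (rule ccontr)
  assume neg: "\<not> ?thesis"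
  have "(T x \<bullet> v) * (x \<bullet> v - T x \<bullet> v) \<le> 0"
    using inner_v_mono[of x] assms(1) by (intro mult_nonneg_nonpos) auto
  moreover have "(T x \<bullet> w) * (x \<bullet> w - T x \<bullet> w) < 0"
    using neg assms(2) by (intro mult_neg_pos) auto
  ultimately show False using orthogonal_step[of x] by simp
qed

text \<open>The line through \<open>x\<close> meets the circle with diameter \<open>[0, x]\<close> only in 0 and \<open>x\<close>, so such a step ends
in 0 or leaves \<open>x\<close> where it is.\<close>

lemma parallel_step_fixed:
  assumes "c *\<^sub>R T x = d *\<^sub>R x" "c \<noteq> 0"
  shows "T x \<in> Fix T"
proof (cases "T x = 0")
  case True
  then show ?thesis using zero_in_Fix by simp
next
  case False
  obtain p q p' q' where s: "dr_split A B x p q p' q'" by (rule dr_split_exists)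
  define k where "k = d / c"
  have Tx: "T x = k *\<^sub>R x"
    using assms unfolding k_def by (simp add: vector_fraction_eq_iff eq_vector_fraction_iff)
  then have "k \<noteq> 0" "x \<noteq> 0" using False by auto
  have "T x \<bullet> (x - T x) = k * ((1 - k) * (x \<bullet> x))"
    unfolding Tx by (simp add: inner_diff_right algebra_simps)
  then have "k = 1"
    using dr_split_identities(6)[OF s] \<open>k \<noteq> 0\<close> \<open>x \<noteq> 0\<close> by simp
  then have "T x = x" using Tx by simp
  then show ?thesis unfolding Fix_T_iff by simp
qed

text \<open>Suppose that the iteration jumps from the upper to the open lower half-plane at \<open>x\<close>, and in the
other direction at \<open>y\<close>. By \<open>quadrant_invariant\<close> both points lie to the side of \<open>- v\<close>, so they can
be scaled to have the same component along \<open>v\<close>. Then \<open>T\<close> reverses their order along \<open>w\<close>, against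
monotonicity.\<close>

lemma half_plane_dichotomy:
  "(\<forall>x. x \<bullet> w \<ge> 0 \<longrightarrow> T x \<bullet> w \<ge> 0) \<or> (\<forall>x. x \<bullet> w \<le> 0 \<longrightarrow> T x \<bullet> w \<le> 0)"
proof (rule ccontr)
  assume "\<not> ?thesis"
  then obtain x y where x: "x \<bullet> w \<ge> 0" "T x \<bullet> w < 0" and y: "y \<bullet> w \<le> 0" "T y \<bullet> w > 0"
    by (meson not_le)
  interpret neg: planar_cone_pair A B v "- w" by (rule planar_cone_pair_uminus)
  have xv: "x \<bullet> v < 0" using quadrant_invariant[of x] x by force
  have yv: "y \<bullet> v < 0" using neg.quadrant_invariant[of y] y by force
  define X Y where XY: "X = (- (y \<bullet> v)) *\<^sub>R x" "Y = (- (x \<bullet> v)) *\<^sub>R y"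
  have T: "T X = (- (y \<bullet> v)) *\<^sub>R T x" "T Y = (- (x \<bullet> v)) *\<^sub>R T y"
    unfolding XY using xv yv by (intro dr_op_scaleR; simp)+
  have v: "(X - Y) \<bullet> v = 0" unfolding XY by (simp add: inner_diff_left)
  have XYw: "X \<bullet> w \<ge> 0" "Y \<bullet> w \<le> 0"
    unfolding XY using x y xv yv by (auto simp: mult_nonneg_nonpos2 mult_nonpos_nonneg mult_nonpos_nonpos)
  have "T X \<bullet> w < 0" "T Y \<bullet> w > 0"
    unfolding T using x y xv yv by (auto simp: mult_neg_neg mult_neg_pos)
  moreover have "0 \<le> (T X - T Y) \<bullet> (X - Y)" by (rule dr_op_monotone)
  then have "0 \<le> (T X \<bullet> w - T Y \<bullet> w) * (X \<bullet> w - Y \<bullet> w)"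
    unfolding inner_coords[of "T X - T Y" "X - Y"] v by (simp add: inner_diff_left)
  ultimately have "X \<bullet> w - Y \<bullet> w \<le> 0" by (simp add: zero_le_mult_iff)
  then have "X \<bullet> w = Y \<bullet> w" using XYw by simp
  then have "X = Y" using v by (intro coords_eqI) (simp_all add: inner_diff_left)
  then show False using \<open>T X \<bullet> w < 0\<close> \<open>T Y \<bullet> w > 0\<close> by simp
qed

text \<open>As long as the iteration stays in the upper half-plane it turns towards \<open>v\<close>. A turn away from \<open>v\<close>
would express \<open>v\<close> as a multiple of \<open>x\<close> minus a multiple of \<open>T x\<close>, with nonnegative coefficients.
Since \<open>v\<close> lies in both cones, its inner products with \<open>q\<close> and \<open>q'\<close> are nonpositive; adding these two
inequalities forces \<open>x = T x\<close> unless \<open>T x\<close> is on the ray opposite to \<open>v\<close>.\<close>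

lemma clockwise_step:
  assumes s: "dr_split A B x p q p' q'" and "x \<bullet> w \<ge> 0" "T x \<bullet> w \<ge> 0"
  shows "(x \<bullet> v) * (T x \<bullet> w) \<le> (x \<bullet> w) * (T x \<bullet> v)
    \<or> (T x \<bullet> w = 0 \<and> T x \<bullet> v < 0 \<and> q \<bullet> q' = 0)"
  (is "?cw \<or> ?ray")
proof (cases ?cw)
  case False
  define D where "D = (x \<bullet> v) * (T x \<bullet> w) - (x \<bullet> w) * (T x \<bullet> v)"
  have D: "D > 0" unfolding D_def using False by simp
  define m where "m = q \<bullet> q'"
  have vD: "D *\<^sub>R v = (T x \<bullet> w) *\<^sub>R x - (x \<bullet> w) *\<^sub>R T x"
    by (intro coords_eqI) (simp_all add: D_def inner_diff_left coords_v algebra_simps)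
  have "q \<bullet> v \<le> 0" "q' \<bullet> v \<le> 0" using s v_in unfolding dr_split_def polar_def by blast+
  then have "(D *\<^sub>R v) \<bullet> q \<le> 0" "(D *\<^sub>R v) \<bullet> q' \<le> 0"
    using D by (simp_all add: inner_commute mult_nonneg_nonpos)
  then have le: "(T x \<bullet> w) * (q \<bullet> q) + (x \<bullet> w) * m \<le> 0"
    "(T x \<bullet> w) * (q' \<bullet> q' + 2 * m) - (x \<bullet> w) * m \<le> 0"
    unfolding vD inner_diff_left m_def using dr_split_identities[OF s] by simp_all
  have "(q + q') \<bullet> (q + q') = q \<bullet> q + q' \<bullet> q' + 2 * m"
    unfolding m_def by (simp add: inner_add_left inner_add_right inner_commute)
  then have "(T x \<bullet> w) * ((q + q') \<bullet> (q + q')) \<le> 0"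
    using le by (simp only: distrib_left)
  moreover have "q + q' \<noteq> 0"
  proof
    assume "q + q' = 0"
    then have "T x = x" using dr_split_identities(1)[OF s] by simp
    then show False using D unfolding D_def by simp
  qed
  then have "(q + q') \<bullet> (q + q') > 0" by simp
  ultimately have w0: "T x \<bullet> w = 0" using assms(3) by (simp add: mult_le_0_iff)
  then have Dx: "(x \<bullet> w) * (T x \<bullet> v) < 0" using D unfolding D_def by simp
  then have "x \<bullet> w > 0" "T x \<bullet> v < 0" using assms(2) by (auto simp: mult_less_0_iff)
  moreover have "(x \<bullet> w) * m = 0" using le unfolding w0 by linarith
  then have "m = 0" using \<open>x \<bullet> w > 0\<close> by simp
  ultimately show ?thesis using w0 unfolding m_def by simp
qed simp

section \<open>Angles\<close>

definition ang :: "'a \<Rightarrow> real" where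
  "ang x = arccos ((x \<bullet> v) / norm x)"

lemma norm_coords: "(norm x)\<^sup>2 = (x \<bullet> v)\<^sup>2 + (x \<bullet> w)\<^sup>2"
  using inner_coords[of x x] unfolding power2_norm_eq_inner by (simp add: power2_eq_square)

lemma ang_polar_coords:
  assumes "x \<noteq> 0"
  shows "0 \<le> ang x" "ang x \<le> pi" "x \<bullet> v = norm x * cos (ang x)"
    and "x \<bullet> w \<ge> 0 \<Longrightarrow> x \<bullet> w = norm x * sin (ang x)"
proof -
  have n: "norm x > 0" using assms by simp
  have "\<bar>x \<bullet> v\<bar> \<le> norm x" using Cauchy_Schwarz_ineq2[of x v] orthonormal by (simp add: norm_eq_sqrt_inner)
  then have b: "\<bar>(x \<bullet> v) / norm x\<bar> \<le> 1" using n by simp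
  then show "0 \<le> ang x" "ang x \<le> pi" unfolding ang_def
    by (simp_all only: abs_le_iff arccos_lbound arccos_ubound minus_le_iff)
  have c: "cos (ang x) = (x \<bullet> v) / norm x" unfolding ang_def using b by (simp add: cos_arccos_abs)
  then show xv: "x \<bullet> v = norm x * cos (ang x)" using n by simp
  assume up: "x \<bullet> w \<ge> 0"
  have "(x \<bullet> w)\<^sup>2 = (norm x)\<^sup>2 * (1 - (cos (ang x))\<^sup>2)"
    using norm_coords[of x] xv by (simp add: power_mult_distrib algebra_simps)
  then have sq: "(x \<bullet> w)\<^sup>2 = (norm x * sin (ang x))\<^sup>2"
    by (simp add: power_mult_distrib flip: sin_squared_eq)
  have "sin (ang x) \<ge> 0" using \<open>0 \<le> ang x\<close> \<open>ang x \<le> pi\<close> by (rule sin_ge_zero)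
  then show "x \<bullet> w = norm x * sin (ang x)"
    by (intro power2_eq_imp_eq[OF sq up]) simp
qed

lemma ang_eq_pi:
  assumes "x \<noteq> 0" "x \<bullet> w = 0" "x \<bullet> v < 0"
  shows "ang x = pi"
proof -
  have "(norm x)\<^sup>2 = (- (x \<bullet> v))\<^sup>2" unfolding norm_coords assms(2) by simp
  then have "norm x = - (x \<bullet> v)" by (rule power2_eq_imp_eq) (use assms(3) in simp_all)
  then show ?thesis unfolding ang_def using assms by (simp add: arccos_minus_1)
qed

text \<open>The image lies on the circle with diameter \<open>[0, x]\<close>, so the angle between \<open>x\<close> and \<open>T x\<close> has cosine
\<open>norm (T x) / norm x\<close>.\<close>

lemma ang_clockwise_step:
  assumes nz: "x \<noteq> 0" "T x \<noteq> 0" and up: "x \<bullet> w \<ge> 0" "T x \<bullet> w \<ge> 0"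
    and cw: "(x \<bullet> v) * (T x \<bullet> w) \<le> (x \<bullet> w) * (T x \<bullet> v)"
  shows "ang (T x) = ang x - arccos (norm (T x) / norm x)"
proof -
  define r r' f f' where d: "r = norm x" "r' = norm (T x)" "f = ang x" "f' = ang (T x)"
  have pos: "r > 0" "r' > 0" unfolding d using nz by auto
  have cx: "x \<bullet> v = r * cos f" "x \<bullet> w = r * sin f" "0 \<le> f" "f \<le> pi"
    and cy: "T x \<bullet> v = r' * cos f'" "T x \<bullet> w = r' * sin f'" "0 \<le> f'" "f' \<le> pi"
    using ang_polar_coords[OF nz(1)] ang_polar_coords[OF nz(2)] up unfolding d by auto
  have one: "cos f' * cos f' + sin f' * sin f' = 1"
    using sin_cos_squared_add[of f'] by (simp add: power2_eq_square)
  have "(r' * r) * cos (f - f') - r' * r' * (cos f' * cos f' + sin f' * sin f') = 0"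
    using orthogonal_step[of x] unfolding cx cy cos_diff by algebra
  then have "r' * (r * cos (f - f') - r') = 0" unfolding one by (simp add: right_diff_distrib)
  then have c: "cos (f - f') = r' / r" using pos by (simp add: field_simps)
  have "(r * r') * sin (f - f') \<ge> 0" using cw unfolding cx cy sin_diff by (simp add: algebra_simps)
  then have sn: "sin (f - f') \<ge> 0" using mult_pos_pos[OF pos] by (simp add: zero_le_mult_iff)
  have "f - f' \<ge> 0"
  proof (rule ccontr)
    assume "\<not> ?thesis"
    then have "0 < f' - f" "f' - f \<le> pi" using cx cy by auto
    moreover have "f' - f \<noteq> pi"
    proof
      assume "f' - f = pi"
      then have "f - f' = - pi" by simp
      then have "cos (f - f') = - 1" by simp
      moreover have "r' / r > 0" using pos by simp
      ultimately show False using c by simp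
    qed
    ultimately have "sin (f' - f) > 0" by (intro sin_gt_zero) auto
    moreover have "sin (f - f') = - sin (f' - f)" by (metis minus_diff_eq sin_minus)
    ultimately show False using sn by simp
  qed
  then have "arccos (cos (f - f')) = f - f'" using cx cy by (intro arccos_cos) auto
  then have "arccos (r' / r) = f - f'" unfolding c .
  then show ?thesis unfolding d by simp
qed

section \<open>One step of the iteration in the upper half-plane\<close>

lemma Fix_on_v_ray: "x \<bullet> w = 0 \<Longrightarrow> x \<bullet> v \<ge> 0 \<Longrightarrow> x \<in> Fix T"
  using expand[of x] cone_scaleR_nonneg[OF cone_A v_in(1), of "x \<bullet> v"]
    cone_scaleR_nonneg[OF cone_B v_in(2), of "x \<bullet> v"] by (intro Fix_if_common) simp_all

text \<open>On \<open>A\<close> the operator is the projection onto \<open>B\<close>. Unless the image is on the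
ray opposite to \<open>v\<close>, this projection turns towards \<open>v\<close> and stays in the cone spanned by \<open>x\<close> and \<open>v\<close>,
which is contained in \<open>A\<close>.\<close>

lemma step_from_A:
  assumes "x \<in> A" "x \<bullet> w > 0" "T x \<bullet> w \<ge> 0" and not_ray: "\<not> (T x \<bullet> w = 0 \<and> T x \<bullet> v < 0)"
  shows "T x \<in> Fix T"
proof -
  obtain p q p' q' where s: "dr_split A B x p q p' q'" by (rule dr_split_exists)
  have "p = x" using reflection_split(3)[OF s] assms(1) by (simp add: closest_point_self)
  then have "T x = p'" using dr_op_split[OF s] s unfolding dr_split_def by simp
  then have "T x \<in> B" using s unfolding dr_split_def by simp
  define c where "c = (x \<bullet> w) * (T x \<bullet> v) - (x \<bullet> v) * (T x \<bullet> w)"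
  have "c \<ge> 0" using clockwise_step[OF s] assms unfolding c_def by auto
  have "(x \<bullet> w) *\<^sub>R T x = (T x \<bullet> w) *\<^sub>R x + c *\<^sub>R v"
    by (intro coords_eqI) (simp_all add: c_def inner_add_left coords_v)
  also have "\<dots> \<in> A" using assms \<open>c \<ge> 0\<close> v_in by (intro cone_combination cone_A)
  finally have "(1 / (x \<bullet> w)) *\<^sub>R ((x \<bullet> w) *\<^sub>R T x) \<in> A"
    by (rule cone_scaleR[OF cone_A]) (use assms(2) in simp)
  then have "T x \<in> A" using assms(2) by simp
  then show ?thesis using \<open>T x \<in> B\<close> by (rule Fix_if_common)
qed

text \<open>Here \<open>z\<close> is on the ray opposite to \<open>v\<close>. If its projection were in the lower half-plane, then the
segment from it to \<open>c\<close> would cross that ray, and the cone would contain \<open>z\<close>.\<close>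

lemma closest_point_above:
  assumes C: "closed_convex_cone C" and z: "z \<bullet> w = 0" "z \<bullet> v < 0" "z \<notin> C"
    and c: "c \<in> C" "c \<bullet> w > 0" "c \<bullet> v < 0"
  shows "closest_point C z \<bullet> w > 0"
proof (rule ccontr)
  define p where "p = closest_point C z"
  assume "\<not> closest_point C z \<bullet> w > 0"
  then have pw: "p \<bullet> w \<le> 0" unfolding p_def by simp
  have pC: "p \<in> C" and res: "(z - p) \<bullet> c \<le> 0" and orth: "p \<bullet> (z - p) = 0"
    using moreau_decomposition[OF C, of z] c(1) unfolding p_def polar_def by auto
  have "z \<bullet> c > 0" using c z inner_coords[of z c] by (simp add: mult_neg_neg)
  then have "p \<noteq> 0" using res by auto
  then have "p \<bullet> z > 0" using orth by (simp add: inner_diff_right)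
  then have "(p \<bullet> v) * (z \<bullet> v) > 0" using z inner_coords[of p z] by simp
  then have pv: "p \<bullet> v < 0" using z by (simp add: zero_less_mult_iff)
  \<comment> \<open>The coefficients cancel the components along \<open>w\<close>.\<close>
  define y where "y = (c \<bullet> w) *\<^sub>R p + (- (p \<bullet> w)) *\<^sub>R c"
  have "y \<in> C" unfolding y_def using pC c pw by (intro cone_combination C) simp_all
  have yw: "y \<bullet> w = 0" unfolding y_def by (simp add: inner_add_left inner_diff_left)
  have "(c \<bullet> w) * (p \<bullet> v) < 0" "(- (p \<bullet> w)) * (c \<bullet> v) \<le> 0"
    using c pv pw by (simp_all add: mult_pos_neg mult_nonpos_nonpos)
  then have yv: "y \<bullet> v < 0" unfolding y_def by (simp add: inner_add_left inner_diff_left)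
  have "z = ((z \<bullet> v) / (y \<bullet> v)) *\<^sub>R y" using z yv yw by (intro coords_eqI) simp_all
  moreover have "((z \<bullet> v) / (y \<bullet> v)) *\<^sub>R y \<in> C"
    using z yv \<open>y \<in> C\<close> by (intro cone_scaleR[OF C]) (simp_all add: divide_neg_neg)
  ultimately show False using z by simp
qed

text \<open>A step along \<open>A\<close> or \<open>B\<close> may end on the ray opposite to \<open>v\<close>, where the angle is largest. Then one
of the two cones contains the image and the other one contains a point on a definite side of that
ray. If the image were not fixed, \<open>closest_point_above\<close> would make the next step leave the upper
half-plane.\<close>

lemma opposite_ray_only_if_fixed:
  assumes invariant: "\<And>x. x \<bullet> w \<ge> 0 \<Longrightarrow> T x \<bullet> w \<ge> 0"
    and x: "x \<bullet> w > 0" "x \<in> A \<or> reflection_op A x \<in> B"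
    and Tx: "T x \<bullet> w = 0" "T x \<bullet> v < 0"
  shows "T x \<in> Fix T"
proof -
  define z where "z = T x"
  have z: "z \<bullet> w = 0" "z \<bullet> v < 0" using Tx unfolding z_def by auto
  obtain p q p' q' where s: "dr_split A B x p q p' q'" by (rule dr_split_exists)
  obtain u y u' y' where r: "dr_split A B z u y u' y'" by (rule dr_split_exists)
  have "z \<in> Fix T"
  proof (cases "x \<in> A")
    case True
    then have "p = x" using reflection_split(3)[OF s] by (simp add: closest_point_self)
    then have q0: "q = 0" using s unfolding dr_split_def by simp
    then have p': "p' = z" using dr_op_split[OF s] unfolding z_def by simp
    then have zB: "z \<in> B" and q': "q' = x - z" "z \<bullet> q' = 0" "q' \<in> polar B"
      using s q0 unfolding dr_split_def by auto
    have "(z \<bullet> v) * (q' \<bullet> v) = 0" using q'(2) inner_coords[of z q'] z by simp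
    then have q'v: "q' \<bullet> v = 0" using z by simp
    then have "x \<bullet> v < 0" using z unfolding q'(1) by (simp add: inner_diff_left)
    show ?thesis
    proof (rule ccontr)
      assume "z \<notin> Fix T"
      then have "z \<notin> A" using Fix_if_common zB by blast
      then have "u \<bullet> w > 0"
        using closest_point_above[OF cone_A z _ True x(1) \<open>x \<bullet> v < 0\<close>] reflection_split(3)[OF r]
        by simp
      moreover have "z = u + y" using r unfolding dr_split_def by simp
      ultimately have yw: "y \<bullet> w < 0" using z by (simp add: inner_add_left)
      have "q' \<bullet> u' \<le> 0" using q'(3) r unfolding dr_split_def polar_def by blast
      moreover have "q' \<bullet> w = x \<bullet> w" using z unfolding q'(1) by (simp add: inner_diff_left)
      ultimately have "(x \<bullet> w) * (u' \<bullet> w) \<le> 0" using inner_coords[of q' u'] q'v by simp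
      then have "u' \<bullet> w \<le> 0" using x(1) by (simp add: mult_le_0_iff)
      then have "T z \<bullet> w < 0" using yw dr_op_split[OF r] by (simp add: inner_add_left)
      then show False using invariant[of z] z by simp
    qed
  next
    case False
    interpret neg: planar_cone_pair A B v "- w" by (rule planar_cone_pair_uminus)
    have pq: "p - q \<in> B" using False x(2) reflection_split(1)[OF s] by simp
    then have "p' = p - q" using reflection_split(4)[OF s] by (simp add: closest_point_self)
    then have pz: "p = z" using dr_op_split[OF s] unfolding z_def by simp
    then have zA: "z \<in> A" and zq: "z \<bullet> q = 0" and xz: "x = z + q"
      using s unfolding dr_split_def by auto
    have "(z \<bullet> v) * (q \<bullet> v) = 0" using zq inner_coords[of z q] z by simp
    then have "q \<bullet> v = 0" using z by simp
    moreover have "q \<bullet> w = x \<bullet> w" using z unfolding xz by (simp add: inner_add_left)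
    ultimately have y0: "(p - q) \<bullet> (- w) > 0" "(p - q) \<bullet> v < 0"
      using x(1) z unfolding pz by (simp_all add: inner_diff_left)
    show ?thesis
    proof (rule ccontr)
      assume "z \<notin> Fix T"
      then have "z \<notin> B" using Fix_if_common zA by blast
      then have "closest_point B z \<bullet> (- w) > 0"
        using neg.closest_point_above[OF cone_B _ z(2) _ pq y0] z(1) by simp
      moreover have "u = z" using reflection_split(3)[OF r] zA by (simp add: closest_point_self)
      then have "y = 0" using r unfolding dr_split_def by simp
      then have "T z = closest_point B z"
        using dr_op_split[OF r] reflection_split(4)[OF r] \<open>u = z\<close> by simp
      ultimately show False using invariant[of z] z by simp
    qed
  qed
  then show ?thesis unfolding z_def .
qed

text \<open>The generic case is \<open>rotated\<close>. The cases \<open>opposite\<close> and \<open>into_A\<close> come from \<open>q = 0\<close> or \<open>q' = 0\<close>, and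
the case \<open>polar\<close> from \<open>p = 0\<close> or \<open>p' = 0\<close>.\<close>

lemma one_step_cases:
  assumes \<rho>: "generic_contraction_factor \<rho>"
    and x: "x \<bullet> w > 0" "T x \<bullet> w \<ge> 0"
  obtains (fixed) "T x \<in> Fix T"
    | (opposite) "x \<in> A \<or> reflection_op A x \<in> B" "T x \<bullet> w = 0" "T x \<bullet> v < 0"
    | (into_A) "T x \<in> A" "T x \<bullet> w > 0"
    | (polar) "x \<in> polar A \<or> T x \<in> polar A"
    | (rotated) "T x \<bullet> w > 0" "ang (T x) \<le> ang x - arccos \<rho>"
proof -
  obtain p q p' q' where s: "dr_split A B x p q p' q'" by (rule dr_split_exists)
  have Tx: "T x = p' + q" by (rule dr_op_split[OF s])
  have h: "p \<in> A" "q \<in> polar A" "p \<bullet> q = 0" "x = p + q" "p' \<in> B" "p' \<bullet> q' = 0" "p - q = p' + q'"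
    using s unfolding dr_split_def by auto
  have "x \<noteq> 0" using x by auto
  consider "q = 0" | "q' = 0" | "p = 0 \<or> p' = 0" | "T x \<in> Fix T"
    | "p \<noteq> 0" "q \<noteq> 0" "p' \<noteq> 0" "q' \<noteq> 0" "T x \<notin> Fix T" by blast
  then show ?thesis
  proof cases
    case 1
    then have "x \<in> A" using h by simp
    then show ?thesis using step_from_A[OF _ x] fixed opposite by blast
  next
    case 2
    then have "p' = p - q" using h by simp
    then have "T x = p" using Tx by simp
    then have "T x \<in> A" using h(1) by simp
    have "reflection_op A x \<in> B"
      using h(5) unfolding \<open>p' = p - q\<close> reflection_split(1)[OF s] .
    consider "T x \<bullet> w > 0" | "T x \<bullet> w = 0" "T x \<bullet> v \<ge> 0" | "T x \<bullet> w = 0" "T x \<bullet> v < 0"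
      using x(2) by linarith
    then show ?thesis
    proof cases
      case 1
      then show ?thesis by (rule into_A[OF \<open>T x \<in> A\<close>])
    next
      case 2
      then show ?thesis using Fix_on_v_ray fixed by blast
    next
      case 3
      then show ?thesis using opposite \<open>reflection_op A x \<in> B\<close> by blast
    qed
  next
    case 3
    then show ?thesis using polar Tx h by auto
  next
    case 4
    then show ?thesis by (rule fixed)
  next
    case 5
    have nz: "T x \<noteq> 0" and "T x \<noteq> x" using 5(5) zero_in_Fix by (auto simp: Fix_T_iff)
    then have le: "norm (T x) \<le> \<rho> * norm x" 
      using \<rho> s 5(1-4) unfolding generic_contraction_factor_def by blast
    have "q \<bullet> q' \<noteq> 0"
    proof
      assume qq': "q \<bullet> q' = 0"
      \<comment> \<open>In the plane two vectors orthogonal to q' are parallel, and then p' = -q.\<close>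
      have "(q \<bullet> q) * (p' \<bullet> p') * (q' \<bullet> q') = (q \<bullet> p')\<^sup>2 * (q' \<bullet> q')"
        using parseval[OF h(6), of q] qq' by simp
      then have "(q \<bullet> q) * (p' \<bullet> p') = (q \<bullet> p')\<^sup>2" using 5 by simp
      moreover have qp': "q \<bullet> p' = - (q \<bullet> q)"
      proof -
        have "p' \<bullet> q + q \<bullet> q = 0"
          using dr_split_identities(2)[OF s] unfolding Tx qq' by (simp add: inner_add_left)
        then show ?thesis by (simp add: inner_commute[of q p'])
      qed
      ultimately have "p' \<bullet> p' = q \<bullet> q" using 5 by (simp add: power2_eq_square)
      then have "(p' + q) \<bullet> (p' + q) = 0"
        using qp' by (simp add: inner_add_left inner_add_right inner_commute)
      then show False using nz unfolding Tx by simp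
    qed
    then have cw: "(x \<bullet> v) * (T x \<bullet> w) \<le> (x \<bullet> w) * (T x \<bullet> v)"
      using clockwise_step[OF s] x by auto
    have "norm (T x) / norm x \<le> \<rho>" using le \<open>x \<noteq> 0\<close> by (simp add: pos_divide_le_eq)
    moreover have "- 1 \<le> norm (T x) / norm x"
      using divide_nonneg_nonneg[OF norm_ge_zero[of "T x"] norm_ge_zero[of x]] by linarith
    ultimately have "arccos \<rho> \<le> arccos (norm (T x) / norm x)"
      using \<rho> unfolding generic_contraction_factor_def by (intro arccos_le_arccos) auto
    then have ang: "ang (T x) \<le> ang x - arccos \<rho>"
      using ang_clockwise_step[OF \<open>x \<noteq> 0\<close> nz _ x(2) cw] x(1) by simp
    show ?thesis
    proof (cases "T x \<bullet> w > 0")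
      case True
      then show ?thesis using ang by (rule rotated)
    next
      case False
      then have w0: "T x \<bullet> w = 0" using x(2) by simp
      have "arccos \<rho> > arccos 1" 
    using \<rho> unfolding generic_contraction_factor_def by (intro arccos_less_arccos) auto
      then have "ang (T x) < pi" using ang ang_polar_coords(2)[OF \<open>x \<noteq> 0\<close>] by simp
      then have "T x \<bullet> v \<ge> 0" using ang_eq_pi[OF nz w0] by force
      then show ?thesis using Fix_on_v_ray w0 fixed by blast
    qed
  qed
qed

text \<open>On \<open>polar A\<close> the operator is the projection onto the dual cone \<open>- polar B\<close>, all of whose points have
nonnegative inner product with \<open>v\<close>.\<close>

lemma step_from_polar:
  assumes "x \<in> polar A"
  shows "T x \<bullet> v \<ge> 0"
proof -
  obtain p q p' q' where s: "dr_split A B x p q p' q'" by (rule dr_split_exists)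
  have "p = 0"
    using closest_point_cone_eqI[OF cone_A cone_zero[OF cone_A] assms] reflection_split(3)[OF s]
    by simp
  then have "- q = p' + q'" using s unfolding dr_split_def by simp
  then have "p' = - q - q'" by (simp add: algebra_simps)
  then have "T x = - q'" using dr_op_split[OF s] by simp
  moreover have "q' \<bullet> v \<le> 0" using s v_in unfolding dr_split_def polar_def by blast
  ultimately show ?thesis by simp
qed

section \<open>A uniform number of iterations\<close>

text \<open>The set \<open>G\<close> collects points for which a uniform bound is already known. The lemma is applied first
with \<open>G\<close> empty to an invariant half-plane, and then to the opposite half-plane with \<open>G\<close> the first
one. Every rotation lowers the angle, which is at most \<open>pi\<close>, by at least \<open>\<theta>\<close>, so there are at most
\<open>K\<close> rotations in a row. From \<open>A\<close> the next point is fixed or in \<open>G\<close>. From \<open>polar A\<close> the next point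
is in \<open>G\<close> or in the quadrant \<open>x \<bullet> v \<ge> 0\<close>, \<open>x \<bullet> w \<ge> 0\<close>, in the interior of which such steps are impossible.\<close>

lemma uniformly_finite_half_plane:
  assumes G: "\<And>x. x \<in> G \<Longrightarrow> (T ^^ N) x \<in> Fix T"
    and invariant: "\<And>x. x \<bullet> w \<ge> 0 \<Longrightarrow> T x \<bullet> w \<ge> 0 \<or> T x \<in> G"
    and opposite: "\<And>x. x \<bullet> w > 0 \<Longrightarrow> x \<in> A \<or> reflection_op A x \<in> B \<Longrightarrow>
      T x \<bullet> w = 0 \<Longrightarrow> T x \<bullet> v < 0 \<Longrightarrow> T x \<in> Fix T \<union> G"
  shows "\<exists>M. \<forall>x. x \<bullet> w \<ge> 0 \<longrightarrow> (T ^^ M) x \<in> Fix T"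
proof -
  obtain \<rho> where \<rho>: "generic_contraction_factor \<rho>" by (rule generic_contraction)
  define \<theta> where "\<theta> = arccos \<rho>"
  have "arccos \<rho> > arccos 1" 
    using \<rho> unfolding generic_contraction_factor_def by (intro arccos_less_arccos) auto
  then have \<theta>: "\<theta> > 0" unfolding \<theta>_def by simp
  obtain K :: nat where "pi / \<theta> < real K" using reals_Archimedean2 by blast
  then have K: "pi < real K * \<theta>" using \<theta> by (simp add: field_simps)
  have GF: "(T ^^ N) y \<in> Fix T" if "y \<in> Fix T \<union> G" for y
    using that G Fix_funpow by (metis Un_iff)
  have from_A: "(T ^^ (N + 1)) x \<in> Fix T" if x: "x \<in> A" "x \<bullet> w > 0" for x
  proof -
    have "T x \<in> Fix T \<union> G"
      using step_from_A[OF x] invariant[of x] opposite[of x] x by auto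
    from GF[OF this] show ?thesis by (rule funpow_Fix_Suc) simp
  qed
  \<comment> \<open>The predicate \<open>Q\<close> restricts the region, so that one induction on the angle serves the quadrant,
    where \<open>polar\<close> is vacuous, and then the whole half-plane.\<close>
  have descend: "(T ^^ (k + M)) x \<in> Fix T"
    if M: "M \<ge> N + 2"
      and Q: "\<And>x. Q x \<Longrightarrow> Q (T x)"
      and polar: "\<And>x. Q x \<Longrightarrow> x \<bullet> w > 0 \<Longrightarrow> x \<in> polar A \<or> T x \<in> polar A \<Longrightarrow> (T ^^ M) x \<in> Fix T"
      and x: "x \<bullet> w > 0" "Q x" "ang x < real k * \<theta>"
    for k M Q x
    using x
  proof (induction k arbitrary: x)
    case 0
    then have "x \<noteq> 0" by auto
    then show ?case using 0 ang_polar_coords(1)[of x] by simp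
  next
    case (Suc k)
    show ?case
    proof (cases "T x \<in> G")
      case True
      then show ?thesis using G M by (intro funpow_Fix_Suc[of N x]) simp_all
    next
      case False
      then have "T x \<bullet> w \<ge> 0" using invariant[of x] Suc.prems(1) by simp
      with \<rho> Suc.prems(1) show ?thesis
      proof (cases rule: one_step_cases)
        case fixed
        then show ?thesis by (intro funpow_Fix_Suc[of 0 x]) simp_all
      next
        case opposite
        then have "T x \<in> Fix T \<union> G" using assms(3) Suc.prems(1) by blast
        then show ?thesis using GF M by (intro funpow_Fix_Suc[of N x]) simp_all
      next
        case into_A
        then show ?thesis using from_A[of "T x"] M by (intro funpow_Fix_Suc[of "N + 1" x]) simp_all
      next
        case polar
        then have "(T ^^ M) x \<in> Fix T" using that(3) Suc.prems by blast
        then show ?thesis by (rule funpow_Fix_mono) simp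
      next
        case rotated
        then have "ang (T x) < real k * \<theta>"
          using Suc.prems(3) unfolding \<theta>_def by (simp add: algebra_simps)
        then have "(T ^^ (k + M)) (T x) \<in> Fix T"
          using Suc.IH rotated Q Suc.prems(2) by blast
        then show ?thesis by (rule funpow_Fix_Suc) simp
      qed
    qed
  qed
  have ang_K: "ang x < real K * \<theta>" if "x \<bullet> w > 0" for x
  proof -
    have "x \<noteq> 0" using that by auto
    then show ?thesis using ang_polar_coords(2)[of x] K by simp
  qed
  define M1 where "M1 = K + (N + 2)"
  have quadrant_interior: "(T ^^ M1) x \<in> Fix T" if "x \<bullet> v > 0" "x \<bullet> w > 0" for x
    unfolding M1_def
  proof (rule descend[where Q = "\<lambda>x. x \<bullet> v > 0"])
    show "T y \<bullet> v > 0" if "y \<bullet> v > 0" for y using inner_v_mono[of y] that by simp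
    show "(T ^^ (N + 2)) y \<in> Fix T"
      if "y \<bullet> v > 0" "y \<bullet> w > 0" "y \<in> polar A \<or> T y \<in> polar A" for y
      using that inner_v_mono[of y] v_in unfolding polar_def by force
  qed (use that ang_K in force)+
  have quadrant: "(T ^^ (M1 + 1)) x \<in> Fix T" if x: "x \<bullet> v \<ge> 0" "x \<bullet> w \<ge> 0" for x
  proof -
    consider "x \<bullet> w = 0" | "x \<bullet> w > 0" "x \<bullet> v > 0" | "x \<bullet> w > 0" "x \<bullet> v = 0" using x by linarith
    then show ?thesis
    proof cases
      case 1
      then show ?thesis using Fix_on_v_ray[OF 1 x(1)] Fix_funpow by metis
    next
      case 2
      then show ?thesis by (intro funpow_Fix_mono[OF quadrant_interior]) simp_all
    next
      case 3
      have y: "T x \<bullet> v \<ge> 0" "T x \<bullet> w \<ge> 0" using inner_v_mono[of x] quadrant_invariant x by auto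
      have "(T ^^ M1) (T x) \<in> Fix T"
      proof (cases "T x \<bullet> v > 0 \<and> T x \<bullet> w > 0")
        case True
        then show ?thesis using quadrant_interior by blast
      next
        case False
        have "(x \<bullet> w) *\<^sub>R T x = (T x \<bullet> w) *\<^sub>R x" if "T x \<bullet> v = 0"
          using 3 that by (intro coords_eqI) simp_all
        then have "T x \<in> Fix T"
          using False y 3 Fix_on_v_ray[of "T x"] parallel_step_fixed[of "x \<bullet> w" x] by fastforce
        then show ?thesis using funpow_Fix_mono[of 0 "T x"] by simp
      qed
      then show ?thesis by (rule funpow_Fix_Suc) simp
    qed
  qed
  define M2 where "M2 = M1 + N + 3"
  have polar_quadrant: "(T ^^ (M1 + N + 2)) x \<in> Fix T" if "x \<in> polar A" "x \<bullet> w \<ge> 0" for x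
  proof (cases "T x \<in> G")
    case True
    then show ?thesis using G by (intro funpow_Fix_Suc[of N x]) simp_all
  next
    case False
    then have "(T ^^ (M1 + 1)) (T x) \<in> Fix T"
      using that step_from_polar invariant by (intro quadrant) force+
    then show ?thesis by (rule funpow_Fix_Suc) simp
  qed
  have polar_step: "(T ^^ M2) x \<in> Fix T" if x: "x \<bullet> w > 0" "x \<in> polar A \<or> T x \<in> polar A" for x
  proof (cases "x \<in> polar A \<or> T x \<in> G")
    case True
    then show ?thesis
      using polar_quadrant[of x] funpow_Fix_mono[of "M1 + N + 2" x M2] x G
        funpow_Fix_Suc[of N x M2] unfolding M2_def by auto
  next
    case False
    then have "(T ^^ (M1 + N + 2)) (T x) \<in> Fix T"
      using x invariant[of x] by (intro polar_quadrant) auto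
    then show ?thesis unfolding M2_def by (rule funpow_Fix_Suc) simp
  qed
  have open_half: "(T ^^ (K + M2)) x \<in> Fix T" if "x \<bullet> w > 0" for x
  proof (rule descend[where Q = "\<lambda>_. True"])
    show "M2 \<ge> N + 2" unfolding M2_def by simp
  qed (use that ang_K polar_step in force)+
  have "(T ^^ (K + M2 + 1)) x \<in> Fix T" if x: "x \<bullet> w \<ge> 0" for x
  proof (cases "x \<bullet> w > 0")
    case True
    then show ?thesis by (intro funpow_Fix_mono[OF open_half]) simp_all
  next
    case False
    then have w0: "x \<bullet> w = 0" using x by simp
    have "(T ^^ (K + M2)) (T x) \<in> Fix T"
    proof (cases "T x \<bullet> w > 0 \<or> T x \<in> G")
      case True
      then show ?thesis using open_half G funpow_Fix_mono[of N "T x"] unfolding M2_def by auto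
    next
      case False
      then have "T x \<bullet> w = 0" using invariant[OF x] by auto
      then have par: "(x \<bullet> v) *\<^sub>R T x = (T x \<bullet> v) *\<^sub>R x"
        using w0 by (intro coords_eqI) simp_all
      have "T x \<in> Fix T"
      proof (cases "x \<bullet> v = 0")
        case True
        then have "x \<in> Fix T" using w0 Fix_on_v_ray by simp
        then show ?thesis by (simp add: Fix_T_iff)
      next
        case False
        then show ?thesis using par parallel_step_fixed by blast
      qed
      then show ?thesis using funpow_Fix_mono[of 0 "T x"] by simp
    qed
    then show ?thesis by (rule funpow_Fix_Suc) simp
  qed
  then show ?thesis by blast
qed

lemma uniformly_finite_if_invariant:
  assumes "\<And>x. x \<bullet> w \<ge> 0 \<Longrightarrow> T x \<bullet> w \<ge> 0"
  shows "\<exists>n. \<forall>x. (T ^^ n) x \<in> Fix T"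
proof -
  interpret neg: planar_cone_pair A B v "- w" by (rule planar_cone_pair_uminus)
  have "\<exists>M. \<forall>x. x \<bullet> w \<ge> 0 \<longrightarrow> (T ^^ M) x \<in> Fix T"
    by (rule uniformly_finite_half_plane[where G = "{}"])
      (use assms opposite_ray_only_if_fixed in auto)
  then obtain M where M: "(T ^^ M) x \<in> Fix T" if "x \<bullet> w \<ge> 0" for x by blast
  have "\<exists>M. \<forall>x. x \<bullet> (- w) \<ge> 0 \<longrightarrow> (T ^^ M) x \<in> Fix T"
    by (rule neg.uniformly_finite_half_plane[where G = "{x. x \<bullet> w \<ge> 0}" and N = M])
      (use M in auto)
  then obtain M' where M': "(T ^^ M') x \<in> Fix T" if "x \<bullet> (- w) \<ge> 0" for x by blast
  have "(T ^^ (M + M')) x \<in> Fix T" for x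
  proof (cases "x \<bullet> w \<ge> 0")
    case True
    from M[OF this] show ?thesis by (rule funpow_Fix_mono) simp
  next
    case False
    then have "x \<bullet> (- w) \<ge> 0" by simp
    from M'[OF this] show ?thesis by (rule funpow_Fix_mono) simp
  qed
  then show ?thesis by blast
qed

lemma uniformly_finite: "\<exists>n. \<forall>x. (T ^^ n) x \<in> Fix T"
proof -
  interpret neg: planar_cone_pair A B v "- w" by (rule planar_cone_pair_uminus)
  show ?thesis
    using half_plane_dichotomy uniformly_finite_if_invariant neg.uniformly_finite_if_invariant
    by fastforce
qed

end

lemma uniformly_finite_if_common_direction:
  fixes A B :: "(real ^ 2) set"
  assumes "closed_convex_cone A" "closed_convex_cone B"
    and v: "v \<in> A" "v \<in> B" "v \<noteq> 0"
  shows "\<exists>n. \<forall>x. (dr_op A B ^^ n) x \<in> Fix (dr_op A B)"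
proof -
  define e where "e = v /\<^sub>R norm v"
  define f :: "real ^ 2" where "f = vector [- e $ 2, e $ 1]"
  have "e \<in> A" "e \<in> B" unfolding e_def using assms by (auto intro: cone_scaleR)
  have "e \<bullet> e = 1" unfolding e_def using v(3) by (simp flip: power2_norm_eq_inner)
  then have unit: "e $ 1 * e $ 1 + e $ 2 * e $ 2 = 1" by (simp add: inner_vec_def sum_2)
  have "x = (x \<bullet> e) *\<^sub>R e + (x \<bullet> f) *\<^sub>R f" for x
  proof -
    have "x $ 1 = (x $ 1 * e $ 1 + x $ 2 * e $ 2) * e $ 1
        + (x $ 1 * (- e $ 2) + x $ 2 * e $ 1) * (- e $ 2)"
      and "x $ 2 = (x $ 1 * e $ 1 + x $ 2 * e $ 2) * e $ 2
        + (x $ 1 * (- e $ 2) + x $ 2 * e $ 1) * e $ 1"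
      using unit by algebra+
    then show ?thesis by (simp add: vec_eq_iff forall_2 inner_vec_def sum_2 f_def)
  qed
  then interpret planar_cone_pair A B e f
    using assms \<open>e \<in> A\<close> \<open>e \<in> B\<close> unit
    by unfold_locales (auto simp: inner_vec_def sum_2 f_def)
  show ?thesis by (rule uniformly_finite)
qed

lemma uniformly_finite_if_nontrivial_Fix:
  fixes A B :: "(real ^ 2) set"
  assumes A: "closed_convex_cone A" and B: "closed_convex_cone B"
    and "Fix (dr_op A B) \<noteq> {0}"
  shows "\<exists>n. \<forall>x. (dr_op A B ^^ n) x \<in> Fix (dr_op A B)"
proof -
  interpret cone_pair A B using A B by unfold_locales
  obtain z where "z \<in> Fix T" "z \<noteq> 0" using assms(3) zero_in_Fix by blast
  then show ?thesis
  proof (cases rule: nonzero_Fix_cases)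
    case (primal v)
    then show ?thesis using uniformly_finite_if_common_direction[OF A B] by blast
  next
    case (dual v)
    have "v \<in> uminus ` polar B" using dual(3) by (metis image_eqI minus_minus)
    then show ?thesis
      using uniformly_finite_if_common_direction[OF closed_convex_cone_polar
          closed_convex_cone_uminus[OF closed_convex_cone_polar] dual(2) _ dual(1)]
        dr_op_polar[OF A B] by metis
  qed
qed

theorem theorem2p2:
  fixes A B :: "(real ^ 2) set"
  assumes "A \<noteq> {}" "closed A" "convex A" "pos_cone A"
    and "B \<noteq> {}" "closed B" "convex B" "pos_cone B"
  shows "(Fix (dr_op A B) \<noteq> {0} \<longrightarrow>
            (\<exists>n. (dr_op A B ^^ n) ` UNIV \<subseteq> Fix (dr_op A B) \<and>
                 (\<forall>x0. \<exists>m\<le>n. (dr_op A B ^^ m) x0 \<in> Fix (dr_op A B)))) \<and>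
         (Fix (dr_op A B) = {0} \<longrightarrow>
            (\<forall>n. (dr_op A B ^^ n) ` (UNIV - Ker (dr_op A B)) \<inter> Fix (dr_op A B) = {}) \<and>
            (\<forall>x0. dr_converges_finitely A B x0 \<longleftrightarrow> x0 \<in> Ker (dr_op A B)))"
proof (intro conjI impI)
  have A: "closed_convex_cone A" and B: "closed_convex_cone B"
    using assms unfolding closed_convex_cone_def by auto
  interpret cone_pair A B using A B by unfold_locales
  {
    assume "Fix T \<noteq> {0}"
    then obtain n where "(T ^^ n) x \<in> Fix T" for x
      using uniformly_finite_if_nontrivial_Fix[OF A B] by blast
    then show "\<exists>n. (T ^^ n) ` UNIV \<subseteq> Fix T \<and> (\<forall>x0. \<exists>m\<le>n. (T ^^ m) x0 \<in> Fix T)"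
      by blast
  next
    assume triv: "Fix T = {0}"
    have Ker: "x \<in> Ker T" if "(T ^^ n) x \<in> Fix T" for n x
      using that trivial_Fix_funpow_zero[OF triv] unfolding triv Ker_def by blast
    then show "\<forall>n. (T ^^ n) ` (UNIV - Ker T) \<inter> Fix T = {}" by blast
    have "(T ^^ 1) x \<in> Fix T" if "x \<in> Ker T" for x
      using that unfolding triv Ker_def by simp
    then show "\<forall>x0. dr_converges_finitely A B x0 \<longleftrightarrow> x0 \<in> Ker T"
      using Ker unfolding dr_converges_finitely_def by blast
  }
qed

end
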